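(* Let $P=(X,\prec)$ be a finite poset and let $t\ge 0$ be an integer. Let $A,B\subseteq X$ be lower ideals and let $C,D\subseteq X$ be upper ideals of $P$ such that $A\cap C=B\cap D=\varnothing$. Set $V:=(A\cap B)\cup(C\cup D)$ and $W:=(A\cup B)\cup(C\cap D)$. Then $$\Omega(X\setminus V,t)\cdot\Omega(X\setminus W,t)\ \ge\ \Omega(X\setminus(A\cup C),t)\cdot\Omega(X\setminus(B\cup D),t).$$ More generally, $$\Omega_q(X\setminus V,t)\cdot\Omega_q(X\setminus W,t)\ \geqslant_q\ \Omega_q(X\setminus(A\cup C),t)\cdot\Omega_q(X\setminus(B\cup D),t).$$
   Context: $\mathbb N=\{0,1,2,\dots\}$. For a subset $Y\subseteq X$ with the induced order, $\mathrm{PP}(Y,t)$ is the set of maps $T:Y\to\{0,1,\dots,t\}$ with $T(x)\le T(y)$ whenever $x\prec y$. Set $\Omega(Y,t):=|\mathrm{PP}(Y,t)|$ and $\Omega_q(Y,t):=\sum_{T\in\mathrm{PP}(Y,t)}q^{|T|}$, where $|T|:=\sum_{x\in Y}T(x)$. A lower ideal is a subset closed under going down in $\prec$; an upper ideal is a subset closed under going up. For polynomials $F,G\in\mathbb R[q]$, $F\geqslant_q G$ means that all coefficients of $F-G$ are nonnegative. *)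

theory Defs
  imports "HOL-Library.FuncSet" "HOL-Computational_Algebra.Polynomial"
begin

text \<open>
  A poset is given by a carrier set \<open>X\<close> and a strict order \<open>lt\<close>, written \<open>\<prec>\<close>, which
  is constrained on \<open>X\<close> only.
\<close>

definition poset_on :: "'a set \<Rightarrow> ('a \<Rightarrow> 'a \<Rightarrow> bool) \<Rightarrow> bool" where
  "poset_on X lt \<longleftrightarrow> irreflp_on X lt \<and> transp_on X lt"

definition lower_ideal :: "'a set \<Rightarrow> ('a \<Rightarrow> 'a \<Rightarrow> bool) \<Rightarrow> 'a set \<Rightarrow> bool" where
  "lower_ideal X lt A \<longleftrightarrow> A \<subseteq> X \<and> (\<forall>x\<in>A. \<forall>y\<in>X. lt y x \<longrightarrow> y \<in> A)"

definition upper_ideal :: "'a set \<Rightarrow> ('a \<Rightarrow> 'a \<Rightarrow> bool) \<Rightarrow> 'a set \<Rightarrow> bool" where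
  "upper_ideal X lt C \<longleftrightarrow> C \<subseteq> X \<and> (\<forall>x\<in>C. \<forall>y\<in>X. lt x y \<longrightarrow> y \<in> C)"

text \<open>
  Maps on \<open>Y\<close> are extensional functions (equal to \<open>undefined\<close> outside \<open>Y\<close>), so that each
  map \<open>Y \<rightarrow> {0..t}\<close> is counted exactly once; in particular there is exactly one map on
  the empty set.
\<close>

definition PP :: "('a \<Rightarrow> 'a \<Rightarrow> bool) \<Rightarrow> 'a set \<Rightarrow> nat \<Rightarrow> ('a \<Rightarrow> nat) set" where
  "PP lt Y t = {T \<in> Y \<rightarrow>\<^sub>E {0..t}. \<forall>x\<in>Y. \<forall>y\<in>Y. lt x y \<longrightarrow> T x \<le> T y}"

definition Omega :: "('a \<Rightarrow> 'a \<Rightarrow> bool) \<Rightarrow> 'a set \<Rightarrow> nat \<Rightarrow> nat" where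
  "Omega lt Y t = card (PP lt Y t)"

definition Omega_q :: "('a \<Rightarrow> 'a \<Rightarrow> bool) \<Rightarrow> 'a set \<Rightarrow> nat \<Rightarrow> real poly" where
  "Omega_q lt Y t = (\<Sum>T\<in>PP lt Y t. monom 1 (\<Sum>x\<in>Y. T x))"

definition coeff_ge :: "real poly \<Rightarrow> real poly \<Rightarrow> bool"  (infix "\<ge>\<^sub>q" 50) where
  "F \<ge>\<^sub>q G \<longleftrightarrow> (\<forall>i. 0 \<le> coeff (F - G) i)"

end

theory Submission
  imports Defs
begin

text \<open>
  An order-preserving map on \<open>X - (A \<union> C)\<close>, where \<open>A\<close> is a lower and \<open>C\<close> an upper ideal,
  extends to an order-preserving map on \<open>X\<close> by giving it a new bottom value on \<open>A\<close> and a new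
  top value on \<open>C\<close>.  For two such extensions \<open>f\<close> and \<open>g\<close>, of type \<open>(A, C)\<close> and \<open>(B, D)\<close>, the
  pointwise minimum has type \<open>(A \<union> B, C \<inter> D)\<close> and the pointwise maximum has type
  \<open>(A \<inter> B, C \<union> D)\<close>, which are the two types on the larger side of the inequality.  At each
  point \<open>f x + g x = min (f x) (g x) + max (f x) (g x)\<close>, so the total weight is preserved.

  The pair (minimum, maximum) does not determine \<open>(f, g)\<close>, so this alone does not give an
  injection.  Fix the minimum \<open>m\<close> and the maximum \<open>M\<close>.  A pair \<open>(f, g)\<close> with these two values is
  given by the set of points at which \<open>f\<close> takes the larger value.  If \<open>s\<close> and \<open>u\<close> are
  the sets of two pairs of type \<open>(A, C)\<close>, \<open>(B, D)\<close>, then the pair given by \<open>s - u\<close> consists of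
  the minimum of the first map of \<open>s\<close> and the second map of \<open>u\<close>, and the maximum of the first
  map of \<open>u\<close> and the second map of \<open>s\<close>; it therefore has the types wanted on the larger side.
  By the Marica--Schoenheim theorem a finite family of sets has at least as many differences
  as members, so the inequality holds in each fibre over \<open>(m, M)\<close>
  (\<open>card_meet_join_fibre_le\<close>).  All pairs in one fibre have the same weight, so summing over the
  fibres gives the inequality for every coefficient, and putting \<open>q = 1\<close> gives the inequality
  of cardinalities.
\<close>

section \<open>Differences of sets\<close>

text \<open>
  This is the inequality in one coordinate.  The mixed products on the left are bounded by
  the mixed products on the right, so only \<open>a + b \<le> P + Q\<close> is at stake, where \<open>P = g0 * g0'\<close>, \<open>Q = g1 * g1'\<close>,
  \<open>a = f0 * f0'\<close> and \<open>b = f1 * f1'\<close>.  Both \<open>a\<close> and \<open>b\<close> are at most \<open>P\<close>, and regrouping factors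
  gives \<open>a * b = (f0 * f1') * (f1 * f0') \<le> P * Q\<close>, so \<open>(P - a) * (P - b) \<ge> 0\<close> yields
  \<open>P * (a + b) \<le> P * (P + Q)\<close>.
\<close>

lemma four_numbers_difference:
  fixes f0 f1 f0' f1' g0 g1 g0' g1' :: real
  assumes nonneg: "f0 \<ge> 0" "f1 \<ge> 0" "f0' \<ge> 0" "f1' \<ge> 0" "g0 \<ge> 0" "g1 \<ge> 0" "g0' \<ge> 0" "g1' \<ge> 0"
    and h00: "f0 * f0' \<le> g0 * g0'" and h11: "f1 * f1' \<le> g0 * g0'"
    and h01: "f0 * f1' \<le> g0 * g1'" and h10: "f1 * f0' \<le> g1 * g0'"
  shows "(f0 + f1) * (f0' + f1') \<le> (g0 + g1) * (g0' + g1')"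
proof -
  define P Q a b where "P = g0 * g0'" and "Q = g1 * g1'" and "a = f0 * f0'" and "b = f1 * f1'"
  have P: "0 \<le> P" and Q: "0 \<le> Q" and a: "0 \<le> a" "a \<le> P" and b: "0 \<le> b" "b \<le> P"
    using assms by (auto simp: P_def Q_def a_def b_def)
  have "a * b = (f0 * f1') * (f1 * f0')"
    by (simp add: a_def b_def)
  also have "\<dots> \<le> (g0 * g1') * (g1 * g0')"
    by (rule mult_mono) (use assms in auto)
  finally have ab: "a * b \<le> P * Q"
    by (simp add: P_def Q_def mult_ac)
  have "a + b \<le> P + Q"
  proof (cases "P = 0")
    case True
    then show ?thesis using a b Q by simp
  next
    case False
    have "0 \<le> (P - a) * (P - b)" using a b by simp
    then have "P * (a + b) \<le> P * (P + Q)" using ab by (simp add: algebra_simps)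
    then show ?thesis using False P by simp
  qed
  then show ?thesis
    using h01 h10 by (simp add: P_def Q_def a_def b_def algebra_simps)
qed

lemma sum_Pow_insert:
  fixes h :: "'a set \<Rightarrow> real"
  assumes "finite S" "a \<notin> S"
  shows "sum h (Pow (insert a S)) = (\<Sum>x\<in>Pow S. h x + h (insert a x))"
proof -
  have inj: "inj_on (insert a) (Pow S)"
    using assms(2) by (intro inj_onI) (metis PowD insert_ident subsetD)
  have "sum h (Pow (insert a S)) = sum h (Pow S) + sum h (insert a ` Pow S)"
    unfolding Pow_insert using assms by (intro sum.union_disjoint) auto
  then show ?thesis
    by (simp add: sum.reindex[OF inj] sum.distrib)
qed

text \<open>
  A weighted form of the Marica--Schoenheim theorem.  Allowing weights makes an induction on
  the ground set possible: summing out one element of it keeps the hypothesis, by the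
  inequality in one coordinate, and on the empty ground set the hypothesis says that the
  square of the one value of \<open>f\<close> is at most the square of the one value of \<open>g\<close>.
\<close>

lemma sum_le_sum_differences:
  fixes f g :: "'a set \<Rightarrow> real"
  assumes "finite S"
    and "\<And>x. x \<subseteq> S \<Longrightarrow> 0 \<le> f x" "\<And>x. x \<subseteq> S \<Longrightarrow> 0 \<le> g x"
    and "\<And>x y. x \<subseteq> S \<Longrightarrow> y \<subseteq> S \<Longrightarrow> f x * f y \<le> g (x - y) * g (y - x)"
  shows "sum f (Pow S) \<le> sum g (Pow S)"
  using assms
proof (induction S arbitrary: f g rule: finite_induct)
  case empty
  have "(f {})\<^sup>2 \<le> (g {})\<^sup>2"
    using empty.prems(3)[OF order_refl order_refl]
    unfolding power2_eq_square by (simp only: Diff_cancel)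
  then show ?case
    using power2_le_imp_le[OF _ empty.prems(2)[OF order_refl]] by simp
next
  case (insert a S)
  have nf: "0 \<le> f x" "0 \<le> f (insert a x)" and ng: "0 \<le> g x" "0 \<le> g (insert a x)"
    if "x \<subseteq> S" for x
    by (rule insert.prems(1) insert.prems(2), use that in auto)+
  have "(\<Sum>x\<in>Pow S. f x + f (insert a x)) \<le> (\<Sum>x\<in>Pow S. g x + g (insert a x))"
  proof (rule insert.IH)
    fix x y assume x: "x \<subseteq> S" and y: "y \<subseteq> S"
    have d: "x - y \<subseteq> S" "y - x \<subseteq> S" using x y by auto
    have ax: "a \<notin> x" "a \<notin> y" using x y insert.hyps by auto
    have e: "insert a x - insert a y = x - y" "insert a y - insert a x = y - x"
      "x - insert a y = x - y" "insert a y - x = insert a (y - x)"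
      "insert a x - y = insert a (x - y)" "y - insert a x = y - x"
      using ax by auto
    have s: "x \<subseteq> insert a S" "y \<subseteq> insert a S" "insert a x \<subseteq> insert a S" "insert a y \<subseteq> insert a S"
      using x y by auto
    have h: "f x * f y \<le> g (x - y) * g (y - x)"
      "f (insert a x) * f (insert a y) \<le> g (x - y) * g (y - x)"
      "f x * f (insert a y) \<le> g (x - y) * g (insert a (y - x))"
      "f (insert a x) * f y \<le> g (insert a (x - y)) * g (y - x)"
      using insert.prems(3)[OF s(1,2)] insert.prems(3)[OF s(3,4)]
        insert.prems(3)[OF s(1,4)] insert.prems(3)[OF s(3,2)] by (simp_all only: e)
    show "(f x + f (insert a x)) * (f y + f (insert a y))
        \<le> (g (x - y) + g (insert a (x - y))) * (g (y - x) + g (insert a (y - x)))"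
      using four_numbers_difference[OF nf[OF x] nf[OF y] ng[OF d(1)] ng[OF d(2)] h] .
  qed (simp_all add: nf ng)
  then show ?case
    using insert.hyps by (simp add: sum_Pow_insert)
qed

text \<open>
  The weighted form is applied to the indicator functions of the family and of its set of
  differences.
\<close>

theorem Marica_Schoenheim:
  fixes F :: "'a set set"
  assumes "finite F" and "\<And>s. s \<in> F \<Longrightarrow> finite s"
  shows "card F \<le> card ((\<lambda>(s, u). s - u) ` (F \<times> F))"
proof -
  define G where "G = (\<lambda>(s, u). s - u) ` (F \<times> F)"
  have fin: "finite (\<Union>F)" using assms by auto
  have "(\<Sum>x\<in>Pow (\<Union>F). if x \<in> F then 1 else 0 :: real)
      \<le> (\<Sum>x\<in>Pow (\<Union>F). if x \<in> G then 1 else 0)"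
    by (rule sum_le_sum_differences[OF fin]) (auto simp: G_def)
  moreover have "Pow (\<Union>F) \<inter> F = F" "Pow (\<Union>F) \<inter> G = G"
    by (auto simp: G_def)
  ultimately show ?thesis
    using fin by (simp add: sum.If_cases G_def)
qed

section \<open>Pairs of functions with given pointwise minimum and maximum\<close>

definition meet_join :: "('a \<Rightarrow> 'b::linorder) \<times> ('a \<Rightarrow> 'b) \<Rightarrow> ('a \<Rightarrow> 'b) \<times> ('a \<Rightarrow> 'b)" where
  "meet_join p = (\<lambda>x. min (fst p x) (snd p x), \<lambda>x. max (fst p x) (snd p x))"

text \<open>
  The set \<open>{x. g x < f x}\<close> encodes a pair \<open>(f, g)\<close> in the fibre over \<open>(m, M)\<close>; it determines the
  pair because the two maps take the values \<open>m x\<close> and \<open>M x\<close> in one order or the other.  The codes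
  of the pairs in \<open>\<alpha> \<times> \<beta>\<close> have at least as many differences as members, and each difference is
  the code of a pair in \<open>\<gamma> \<times> \<delta>\<close> in the same fibre.
\<close>

lemma card_meet_join_fibre_le:
  fixes \<alpha> \<beta> \<gamma> \<delta> :: "('a \<Rightarrow> 'b::linorder) set"
  assumes fin: "finite \<alpha>" "finite \<beta>" "finite \<gamma>" "finite \<delta>"
    and supp: "\<And>f g. f \<in> \<alpha> \<Longrightarrow> g \<in> \<beta> \<Longrightarrow> finite {x. f x \<noteq> g x}"
    and meet: "\<And>f g. f \<in> \<alpha> \<Longrightarrow> g \<in> \<beta> \<Longrightarrow> (\<lambda>x. min (f x) (g x)) \<in> \<gamma>"
    and join: "\<And>f g. f \<in> \<alpha> \<Longrightarrow> g \<in> \<beta> \<Longrightarrow> (\<lambda>x. max (f x) (g x)) \<in> \<delta>"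
  shows "card {p \<in> \<alpha> \<times> \<beta>. meet_join p = k} \<le> card {p \<in> \<gamma> \<times> \<delta>. meet_join p = k}"
proof -
  obtain m M where k: "k = (m, M)" by (cases k)
  define P where "P = {p \<in> \<alpha> \<times> \<beta>. meet_join p = k}"
  define Q where "Q = {p \<in> \<gamma> \<times> \<delta>. meet_join p = k}"
  define code where "code p = {x. snd p x < fst p x}" for p :: "('a \<Rightarrow> 'b) \<times> ('a \<Rightarrow> 'b)"
  define pr where "pr s = (\<lambda>x. if x \<in> s then M x else m x, \<lambda>x. if x \<in> s then m x else M x)" for s
  define F where "F = code ` P"
  define G where "G = (\<lambda>(s, u). s - u) ` (F \<times> F)"
  have finP: "finite P" and finQ: "finite Q"
    using fin by (auto simp: P_def Q_def)
  have pr_code: "pr (code p) = p" if "p \<in> P" for p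
  proof -
    have "m = (\<lambda>x. min (fst p x) (snd p x))" "M = (\<lambda>x. max (fst p x) (snd p x))"
      using that by (auto simp: P_def k meet_join_def)
    then show ?thesis
      by (intro prod_eqI ext) (auto simp: pr_def code_def)
  qed
  have F_lt: "m x < M x" if "s \<in> F" "x \<in> s" for s x
    using that by (auto simp: F_def code_def P_def k meet_join_def)
  have code_pr: "code (pr v) = v" if "v \<in> G" for v
  proof -
    have "m x < M x" if "x \<in> v" for x
      using that \<open>v \<in> G\<close> F_lt by (auto simp: G_def)
    moreover have "m x \<le> M x" for x
    proof -
      obtain p where "p \<in> P" using \<open>v \<in> G\<close> by (auto simp: G_def F_def)
      then show ?thesis by (auto simp: P_def k meet_join_def min_le_iff_disj)
    qed
    ultimately show ?thesis
      by (auto simp: code_def pr_def not_less dest: leD split: if_splits)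
  qed
  have pr_G: "pr v \<in> Q" if v: "v \<in> G" for v
  proof -
    obtain p p' where p: "p \<in> P" "p' \<in> P" and v': "v = code p - code p'"
      using v by (auto simp: G_def F_def)
    have mM: "m x \<le> M x" for x
      using p(1) by (auto simp: P_def k meet_join_def min_le_iff_disj)
    have mem: "fst p \<in> \<alpha>" "snd p \<in> \<beta>" "fst p' \<in> \<alpha>" "snd p' \<in> \<beta>"
      using p by (auto simp: P_def)
    have q: "p = pr (code p)" "p' = pr (code p')"
      using pr_code p by auto
    \<comment> \<open>The first map of \<open>p\<close> is \<open>M\<close> on \<open>code p\<close>, and the second map of \<open>p'\<close> is \<open>M\<close> off \<open>code p'\<close>;
      both hold exactly on \<open>v\<close>, so their minimum is \<open>M\<close> on \<open>v\<close> and \<open>m\<close> elsewhere.  The maximum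
      below is the dual.\<close>
    have "fst (pr v) = (\<lambda>x. min (fst (pr (code p)) x) (snd (pr (code p')) x))"
      using mM by (auto simp: v' pr_def fun_eq_iff min_def antisym)
    then have "fst (pr v) \<in> \<gamma>"
      using meet[OF mem(1) mem(4)] q by metis
    moreover have "snd (pr v) = (\<lambda>x. max (fst (pr (code p')) x) (snd (pr (code p)) x))"
      using mM by (auto simp: v' pr_def fun_eq_iff max_def antisym)
    then have "snd (pr v) \<in> \<delta>"
      using join[OF mem(3) mem(2)] q by metis
    moreover have "meet_join (pr v) = k"
      using mM by (auto simp: meet_join_def pr_def k fun_eq_iff)
    ultimately show ?thesis
      by (auto simp: Q_def mem_Times_iff)
  qed
  have "card P = card F"
    unfolding F_def by (rule card_image[symmetric]) (rule inj_on_inverseI[where g = pr], rule pr_code)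
  also have "\<dots> \<le> card G"
    unfolding G_def
  proof (rule Marica_Schoenheim)
    show "finite F" using finP by (simp add: F_def)
    fix s assume "s \<in> F"
    then obtain f g where fg: "f \<in> \<alpha>" "g \<in> \<beta>" and s: "s = {x. g x < f x}"
      by (auto simp: F_def code_def P_def)
    have "s \<subseteq> {x. f x \<noteq> g x}" using s by auto
    then show "finite s" by (rule finite_subset[OF _ supp[OF fg]])
  qed
  also have "\<dots> = card (pr ` G)"
    by (rule card_image[symmetric]) (rule inj_on_inverseI[where g = code], rule code_pr)
  also have "\<dots> \<le> card Q"
    using pr_G finQ by (intro card_mono) auto
  finally show ?thesis
    by (simp add: P_def Q_def)
qed

lemma sum_le_sum_fibrewise:
  fixes w :: "'k \<Rightarrow> real"
  assumes "finite P" "finite Q" and nonneg: "\<And>k. 0 \<le> w k"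
    and le: "\<And>k. card {p \<in> P. \<phi> p = k} \<le> card {p \<in> Q. \<phi> p = k}"
  shows "(\<Sum>p\<in>P. w (\<phi> p)) \<le> (\<Sum>p\<in>Q. w (\<phi> p))"
proof -
  define K where "K = \<phi> ` (P \<union> Q)"
  have fibres: "(\<Sum>p\<in>R. w (\<phi> p)) = (\<Sum>k\<in>K. real (card {p \<in> R. \<phi> p = k}) * w k)"
    if "finite R" "R \<subseteq> P \<union> Q" for R
  proof -
    have "(\<Sum>p\<in>R. w (\<phi> p)) = (\<Sum>k\<in>K. \<Sum>p\<in>{p \<in> R. \<phi> p = k}. w (\<phi> p))"
      by (rule sum.group[symmetric]) (use that assms in \<open>auto simp: K_def\<close>)
    then show ?thesis by simp
  qed
  have "(\<Sum>k\<in>K. real (card {p \<in> P. \<phi> p = k}) * w k)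
      \<le> (\<Sum>k\<in>K. real (card {p \<in> Q. \<phi> p = k}) * w k)"
    by (intro sum_mono mult_right_mono of_nat_mono le nonneg)
  then show ?thesis
    using fibres[of P] fibres[of Q] assms(1,2) by simp
qed

section \<open>Extending an order-preserving map by a bottom and a top value\<close>

text \<open>
  Values are shifted by one, so that \<open>0\<close> is the new bottom value and \<open>t + 2\<close> the new top value.
  The value off \<open>X\<close> is fixed to make each extension unique.
\<close>

definition extended_maps ::
  "('a \<Rightarrow> 'a \<Rightarrow> bool) \<Rightarrow> 'a set \<Rightarrow> nat \<Rightarrow> 'a set \<Rightarrow> 'a set \<Rightarrow> ('a \<Rightarrow> nat) set" where
  "extended_maps lt X t A C =
     {U. (\<forall>x. x \<notin> X \<longrightarrow> U x = 0) \<and> (\<forall>x\<in>X. U x \<le> t + 2)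
       \<and> (\<forall>x\<in>X. U x = 0 \<longleftrightarrow> x \<in> A) \<and> (\<forall>x\<in>X. U x = t + 2 \<longleftrightarrow> x \<in> C)
       \<and> (\<forall>x\<in>X. \<forall>y\<in>X. lt x y \<longrightarrow> U x \<le> U y)}"

definition extend_map :: "'a set \<Rightarrow> nat \<Rightarrow> 'a set \<Rightarrow> 'a set \<Rightarrow> ('a \<Rightarrow> nat) \<Rightarrow> 'a \<Rightarrow> nat" where
  "extend_map X t A C T =
     (\<lambda>x. if x \<notin> X \<or> x \<in> A then 0 else if x \<in> C then t + 2 else T x + 1)"

lemma bij_betw_extend_map:
  assumes "lower_ideal X lt A" "upper_ideal X lt C" "A \<inter> C = {}"
  shows "bij_betw (extend_map X t A C) (PP lt (X - (A \<union> C)) t) (extended_maps lt X t A C)"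
proof (rule bij_betw_byWitness[where f' = "\<lambda>U. restrict (\<lambda>x. U x - 1) (X - (A \<union> C))"])
  show "\<forall>T\<in>PP lt (X - (A \<union> C)) t.
      restrict (\<lambda>x. extend_map X t A C T x - 1) (X - (A \<union> C)) = T"
    by (auto simp: PP_def extend_map_def fun_eq_iff restrict_def PiE_def extensional_def)
  show "\<forall>U\<in>extended_maps lt X t A C.
      extend_map X t A C (restrict (\<lambda>x. U x - 1) (X - (A \<union> C))) = U"
    using assms
    by (auto simp: extended_maps_def extend_map_def fun_eq_iff lower_ideal_def upper_ideal_def)
  show "extend_map X t A C ` PP lt (X - (A \<union> C)) t \<subseteq> extended_maps lt X t A C"
  proof (rule image_subsetI)
    fix T assume T: "T \<in> PP lt (X - (A \<union> C)) t"
    have bound: "T x \<le> t" if "x \<in> X" "x \<notin> A" "x \<notin> C" for x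
      using T that by (auto simp: PP_def PiE_def Pi_def)
    have mono: "T x \<le> T y" if "x \<in> X" "x \<notin> A" "x \<notin> C" "y \<in> X" "y \<notin> A" "y \<notin> C" "lt x y" for x y
      using T that by (auto simp: PP_def)
    have low: "x \<in> A" if "y \<in> A" "x \<in> X" "lt x y" for x y
      using assms(1) that by (auto simp: lower_ideal_def)
    have up: "y \<in> C" if "x \<in> C" "y \<in> X" "lt x y" for x y
      using assms(2) that by (auto simp: upper_ideal_def)
    have top_iff: "extend_map X t A C T x = t + 2 \<longleftrightarrow> x \<in> C" if "x \<in> X" for x
      using bound[of x] that assms(3) by (auto simp: extend_map_def)
    have le_top: "extend_map X t A C T x \<le> t + 2" if "x \<in> X" for x
      using bound[of x] that by (auto simp: extend_map_def)
    have "extend_map X t A C T x \<le> extend_map X t A C T y" if xy: "x \<in> X" "y \<in> X" "lt x y" for x y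
    proof (cases "y \<in> C")
      case True
      then show ?thesis using top_iff[of y] le_top[of x] xy by simp
    next
      case False
      then show ?thesis
        using low[of y x] up[of x y] mono[of x y] xy by (auto simp: extend_map_def)
    qed
    moreover have "extend_map X t A C T x = 0 \<longleftrightarrow> x \<in> A" if "x \<in> X" for x
      using that by (simp add: extend_map_def)
    ultimately show "extend_map X t A C T \<in> extended_maps lt X t A C"
      using top_iff le_top by (simp add: extended_maps_def) (simp add: extend_map_def)
  qed
  show "(\<lambda>U. restrict (\<lambda>x. U x - 1) (X - (A \<union> C))) ` extended_maps lt X t A C
      \<subseteq> PP lt (X - (A \<union> C)) t"
  proof (rule image_subsetI)
    fix U assume U: "U \<in> extended_maps lt X t A C"
    have "U x - 1 \<le> t" if "x \<in> X - (A \<union> C)" for x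
    proof -
      have "U x \<le> t + 2" "U x \<noteq> t + 2" using U that by (auto simp: extended_maps_def)
      then show ?thesis by simp
    qed
    then show "restrict (\<lambda>x. U x - 1) (X - (A \<union> C)) \<in> PP lt (X - (A \<union> C)) t"
      using U by (auto simp: PP_def extended_maps_def intro: diff_le_mono)
  qed
qed

lemma finite_extended_maps:
  assumes "finite X"
  shows "finite (extended_maps lt X t A C)"
proof (rule finite_subset)
  show "extended_maps lt X t A C \<subseteq> {U. \<forall>x. (x \<in> X \<longrightarrow> U x \<in> {0..t + 2}) \<and> (x \<notin> X \<longrightarrow> U x = 0)}"
    by (auto simp: extended_maps_def)
  show "finite {U. \<forall>x. (x \<in> X \<longrightarrow> U x \<in> {0..t + 2}) \<and> (x \<notin> X \<longrightarrow> U x = 0)}"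
    by (rule finite_set_of_finite_funs) (use assms in auto)
qed

text \<open>
  A minimum takes the bottom value where one of the two maps does, and the top value where
  both do; for the maximum the roles are exchanged.
\<close>

lemma min_extended_maps:
  assumes "f \<in> extended_maps lt X t A C" "g \<in> extended_maps lt X t B D"
  shows "(\<lambda>x. min (f x) (g x)) \<in> extended_maps lt X t (A \<union> B) (C \<inter> D)"
proof -
  have *: "min a b = c \<longleftrightarrow> a = c \<and> b = c" if "a \<le> c" "b \<le> c" for a b c :: nat
    using that by (auto simp: min_def)
  have z: "min a b = 0 \<longleftrightarrow> a = 0 \<or> b = 0" for a b :: nat
    by (auto simp: min_def)
  show ?thesis
    using assms unfolding extended_maps_def
    by (simp add: * z) (auto simp: min_le_iff_disj)
qed

lemma max_extended_maps:
  assumes "f \<in> extended_maps lt X t A C" "g \<in> extended_maps lt X t B D"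
  shows "(\<lambda>x. max (f x) (g x)) \<in> extended_maps lt X t (A \<inter> B) (C \<union> D)"
proof -
  have *: "max a b = c \<longleftrightarrow> a = c \<or> b = c" if "a \<le> c" "b \<le> c" for a b c :: nat
    using that by (auto simp: max_def)
  have z: "max a b = 0 \<longleftrightarrow> a = 0 \<and> b = 0" for a b :: nat
    by (auto simp: max_def)
  show ?thesis
    using assms unfolding extended_maps_def
    by (simp add: * z) (auto simp: le_max_iff_disj)
qed

text \<open>
  The amount that \<open>extend_map\<close> adds to the sum of the values: one for each point outside
  \<open>A \<union> C\<close>, by the shift, and the top value for each point of \<open>C\<close>.
\<close>

definition extension_weight :: "'a set \<Rightarrow> nat \<Rightarrow> 'a set \<Rightarrow> 'a set \<Rightarrow> nat" where
  "extension_weight X t A C = card (X - (A \<union> C)) + (t + 2) * card C"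

lemma sum_extend_map:
  assumes "finite X" "A \<subseteq> X" "C \<subseteq> X" "A \<inter> C = {}"
  shows "(\<Sum>x\<in>X. extend_map X t A C T x) = extension_weight X t A C + (\<Sum>x\<in>X - (A \<union> C). T x)"
proof -
  let ?e = "extend_map X t A C T" and ?Y = "X - (A \<union> C)"
  have fin: "finite A" "finite C" "finite ?Y" using assms finite_subset by blast+
  have "sum ?e X = sum ?e (A \<union> (C \<union> ?Y))"
    by (rule arg_cong[where f = "sum ?e"]) (use assms in auto)
  also have "\<dots> = sum ?e A + (sum ?e C + sum ?e ?Y)"
    using fin assms by (subst sum.union_disjoint; (subst sum.union_disjoint)?) auto
  also have "sum ?e A = 0"
    by (simp add: extend_map_def)
  also have "sum ?e C = (\<Sum>x\<in>C. t + 2)"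
    by (rule sum.cong) (use assms in \<open>auto simp: extend_map_def\<close>)
  also have "sum ?e ?Y = (\<Sum>x\<in>?Y. T x + 1)"
    by (rule sum.cong) (auto simp: extend_map_def)
  finally show ?thesis
    by (simp add: extension_weight_def sum.distrib sum_Suc)
qed

lemma Omega_q_extended_maps:
  assumes "finite X" "lower_ideal X lt A" "upper_ideal X lt C" "A \<inter> C = {}"
  shows "monom 1 (extension_weight X t A C) * Omega_q lt (X - (A \<union> C)) t
    = (\<Sum>U\<in>extended_maps lt X t A C. monom 1 (\<Sum>x\<in>X. U x))"
proof -
  have sub: "A \<subseteq> X" "C \<subseteq> X"
    using assms by (auto simp: lower_ideal_def upper_ideal_def)
  have "(\<Sum>U\<in>extended_maps lt X t A C. monom 1 (\<Sum>x\<in>X. U x) :: real poly)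
      = (\<Sum>T\<in>PP lt (X - (A \<union> C)) t. monom 1 (\<Sum>x\<in>X. extend_map X t A C T x))"
    by (rule sum.reindex_bij_betw[OF bij_betw_extend_map[OF assms(2-4)], symmetric])
  also have "\<dots> = monom 1 (extension_weight X t A C) * Omega_q lt (X - (A \<union> C)) t"
    using sum_extend_map[OF assms(1) sub assms(4)]
    by (simp add: Omega_q_def sum_distrib_left mult_monom)
  finally show ?thesis by simp
qed

lemma Omega_q_product_extended_maps:
  assumes "finite X" "lower_ideal X lt A" "upper_ideal X lt C" "A \<inter> C = {}"
    and "lower_ideal X lt B" "upper_ideal X lt D" "B \<inter> D = {}"
  shows "monom 1 (extension_weight X t A C + extension_weight X t B D)
      * (Omega_q lt (X - (A \<union> C)) t * Omega_q lt (X - (B \<union> D)) t)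
    = (\<Sum>p\<in>extended_maps lt X t A C \<times> extended_maps lt X t B D.
        monom 1 (\<Sum>x\<in>X. fst p x + snd p x))"
proof -
  have "monom 1 (extension_weight X t A C + extension_weight X t B D)
      * (Omega_q lt (X - (A \<union> C)) t * Omega_q lt (X - (B \<union> D)) t)
    = (monom 1 (extension_weight X t A C) * Omega_q lt (X - (A \<union> C)) t)
      * (monom 1 (extension_weight X t B D) * Omega_q lt (X - (B \<union> D)) t)"
    using mult_monom[of "1::real" "extension_weight X t A C" 1 "extension_weight X t B D"]
    by (simp add: mult_ac)
  then show ?thesis
    using assms
    by (simp add: Omega_q_extended_maps sum_product sum.cartesian_product mult_monom
        sum.distrib case_prod_beta)
qed

text \<open>
  The correction factors on the two sides of the final inequality agree, so they cancel.  This
  holds because cardinality is modular and each pair of ideals here is disjoint.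
\<close>

lemma extension_weight_modular:
  assumes "finite X" "A \<subseteq> X" "B \<subseteq> X" "C \<subseteq> X" "D \<subseteq> X" "A \<inter> C = {}" "B \<inter> D = {}"
  shows "extension_weight X t A C + extension_weight X t B D
    = extension_weight X t (A \<union> B) (C \<inter> D) + extension_weight X t (A \<inter> B) (C \<union> D)"
proof -
  have fin: "finite A" "finite B" "finite C" "finite D"
    using assms finite_subset by blast+
  have compl: "card (X - (E \<union> G)) + card E + card G = card X"
    if "E \<subseteq> X" "G \<subseteq> X" "E \<inter> G = {}" for E G
  proof -
    have fEG: "finite E" "finite G" using that assms(1) finite_subset by blast+
    have "card (X - (E \<union> G)) + card (E \<union> G) = card X"
      using assms(1) that by (metis Un_least add.commute card_Diff_subset card_mono
          finite_subset le_add_diff_inverse)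
    then show ?thesis using that fEG by (simp add: card_Un_disjoint)
  qed
  have "card (X - (A \<union> C)) + card A + card C = card X"
    "card (X - (B \<union> D)) + card B + card D = card X"
    "card (X - ((A \<union> B) \<union> (C \<inter> D))) + card (A \<union> B) + card (C \<inter> D) = card X"
    "card (X - ((A \<inter> B) \<union> (C \<union> D))) + card (A \<inter> B) + card (C \<union> D) = card X"
    by (rule compl; use assms in blast)+
  moreover have AB: "card A + card B = card (A \<union> B) + card (A \<inter> B)"
    using card_Un_Int fin by blast
  moreover have CD: "card C + card D = card (C \<union> D) + card (C \<inter> D)"
    using card_Un_Int fin by blast
  moreover have "(t + 2) * card C + (t + 2) * card D
      = (t + 2) * card (C \<union> D) + (t + 2) * card (C \<inter> D)"
    using CD by (metis distrib_left)
  ultimately show ?thesis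
    unfolding extension_weight_def by linarith
qed

section \<open>The inequality\<close>

lemma coeff_ge_monom_mult_cancel:
  assumes "monom 1 n * F \<ge>\<^sub>q monom 1 n * G"
  shows "F \<ge>\<^sub>q G"
  unfolding coeff_ge_def
proof
  fix i
  have "0 \<le> coeff (monom 1 n * (F - G)) (i + n)"
    using assms by (simp add: coeff_ge_def right_diff_distrib)
  then show "0 \<le> coeff (F - G) i"
    by (simp add: coeff_monom_mult)
qed

lemma coeff_ge_imp_poly_1_ge:
  assumes "F \<ge>\<^sub>q G"
  shows "poly G 1 \<le> poly F 1"
proof -
  have "0 \<le> poly (F - G) 1"
    using assms unfolding poly_altdef coeff_ge_def by (intro sum_nonneg) auto
  then show ?thesis by simp
qed

lemma Omega_q_at_1: "poly (Omega_q lt Y t) 1 = real (Omega lt Y t)"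
  by (simp add: Omega_q_def Omega_def poly_sum poly_monom)

text \<open>
  The exponent of a pair of extended maps depends only on its fibre, as it equals
  \<open>\<Sum>x\<in>X. m x + M x\<close> on the fibre over \<open>(m, M)\<close>.  So every coefficient is a sum over the fibres
  with weights \<open>0\<close> and \<open>1\<close>.
\<close>

lemma sum_extended_maps_coeff_ge:
  assumes "finite X"
  shows "(\<Sum>p\<in>extended_maps lt X t (A \<union> B) (C \<inter> D) \<times> extended_maps lt X t (A \<inter> B) (C \<union> D).
        monom 1 (\<Sum>x\<in>X. fst p x + snd p x))
    \<ge>\<^sub>q (\<Sum>p\<in>extended_maps lt X t A C \<times> extended_maps lt X t B D.
        monom 1 (\<Sum>x\<in>X. fst p x + snd p x))"
    (is "(\<Sum>p\<in>?Q. monom 1 (?wt p)) \<ge>\<^sub>q (\<Sum>p\<in>?P. monom 1 (?wt p))")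
  unfolding coeff_ge_def
proof
  fix i
  define w where
    "w k = coeff (monom (1::real) (\<Sum>x\<in>X. fst k x + snd k x)) i" for k :: "('a \<Rightarrow> nat) \<times> ('a \<Rightarrow> nat)"
  have w: "w (meet_join p) = coeff (monom 1 (?wt p)) i" for p
  proof -
    have "min a b + max a b = a + b" for a b :: nat
      by (simp add: min_def max_def)
    then show ?thesis
      by (simp add: w_def meet_join_def)
  qed
  have "(\<Sum>p\<in>?P. w (meet_join p)) \<le> (\<Sum>p\<in>?Q. w (meet_join p))"
  proof (rule sum_le_sum_fibrewise[where w = w and \<phi> = meet_join])
    fix k
    show "card {p \<in> ?P. meet_join p = k} \<le> card {p \<in> ?Q. meet_join p = k}"
    proof (rule card_meet_join_fibre_le)
      fix f g assume "f \<in> extended_maps lt X t A C" "g \<in> extended_maps lt X t B D"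
      then have "{x. f x \<noteq> g x} \<subseteq> X"
        unfolding extended_maps_def by force
      then show "finite {x. f x \<noteq> g x}"
        using assms finite_subset by blast
    qed (use assms in \<open>simp_all add: finite_extended_maps min_extended_maps max_extended_maps\<close>)
  qed (use assms in \<open>auto simp: finite_extended_maps w_def\<close>)
  then show "(0::real) \<le> coeff ((\<Sum>p\<in>?Q. monom 1 (?wt p)) - (\<Sum>p\<in>?P. monom 1 (?wt p))) i"
    by (simp only: w coeff_sum coeff_diff diff_ge_0_iff_ge)
qed

theorem theorem4p8:
  fixes X A B C D V W :: "'a set"
    and lt :: "'a \<Rightarrow> 'a \<Rightarrow> bool"
    and t :: nat
  assumes "finite X" and "poset_on X lt"
    and "lower_ideal X lt A" and "lower_ideal X lt B"
    and "upper_ideal X lt C" and "upper_ideal X lt D"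
    and "A \<inter> C = {}" and "B \<inter> D = {}"
    and "V = (A \<inter> B) \<union> (C \<union> D)"
    and "W = (A \<union> B) \<union> (C \<inter> D)"
  shows "Omega lt (X - V) t * Omega lt (X - W) t
           \<ge> Omega lt (X - (A \<union> C)) t * Omega lt (X - (B \<union> D)) t
       \<and> Omega_q lt (X - V) t * Omega_q lt (X - W) t
           \<ge>\<^sub>q Omega_q lt (X - (A \<union> C)) t * Omega_q lt (X - (B \<union> D)) t"
proof -
  have ideals: "lower_ideal X lt (A \<union> B)" "lower_ideal X lt (A \<inter> B)"
    "upper_ideal X lt (C \<inter> D)" "upper_ideal X lt (C \<union> D)"
    using assms(3-6) unfolding lower_ideal_def upper_ideal_def by blast+
  have disj: "(A \<union> B) \<inter> (C \<inter> D) = {}" "(A \<inter> B) \<inter> (C \<union> D) = {}"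
    using assms(7,8) by auto
  have sub: "A \<subseteq> X" "B \<subseteq> X" "C \<subseteq> X" "D \<subseteq> X"
    using assms(3-6) by (auto simp: lower_ideal_def upper_ideal_def)
  let ?n = "extension_weight X t A C + extension_weight X t B D"
  let ?L = "Omega_q lt (X - (A \<union> C)) t * Omega_q lt (X - (B \<union> D)) t"
  have "monom 1 ?n * (Omega_q lt (X - W) t * Omega_q lt (X - V) t) \<ge>\<^sub>q monom 1 ?n * ?L"
    using sum_extended_maps_coeff_ge[OF assms(1), of lt t A B C D]
      Omega_q_product_extended_maps[OF assms(1,3,5,7,4,6,8), of t]
      Omega_q_product_extended_maps[OF assms(1) ideals(1,3) disj(1) ideals(2,4) disj(2), of t]
      extension_weight_modular[OF assms(1) sub assms(7,8), of t]
    unfolding assms(9,10) by simp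
  then have q: "Omega_q lt (X - V) t * Omega_q lt (X - W) t \<ge>\<^sub>q ?L"
    using coeff_ge_monom_mult_cancel by (metis mult.commute)
  have "real (Omega lt (X - (A \<union> C)) t * Omega lt (X - (B \<union> D)) t)
      \<le> real (Omega lt (X - V) t * Omega lt (X - W) t)"
    using coeff_ge_imp_poly_1_ge[OF q] by (simp add: Omega_q_at_1)
  then show ?thesis
    using q by (simp only: of_nat_le_iff)
qed

end
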